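(* Let $U_i=\begin{pmatrix}\alpha_i&\beta_i\\0&\gamma_i\end{pmatrix}$, $i=1,2$, be upper triangular matrices with entries in an associative unital algebra $\mathcal A$ over a field $k$, with $\alpha_i,\gamma_i$ invertible in $\mathcal A$. For $n,m\in\mathbf Z$ write $U_1^nU_2^m=\begin{pmatrix}\alpha(n,m)&\beta(n,m)\\0&\gamma(n,m)\end{pmatrix}$. Let $q\in k$ be invertible with $q\ne 1$, and (for type III) let $r\in k$ be invertible with $r\neq 1$. If $(U_1,U_2)$ is of type I (relations (ID1), (IND1), (MD1), (MND)) or of type II (relations (ID2), (IND1), (MD2), (MND)), then $(U_1,U_2)$ is a quantum matrix pair; if $(U_1,U_2)$ is of type III (relations (ID2), (IND2), (MD2), (MND)), then $(U_1,U_2)$ is a restricted quantum matrix pair. In all three cases, in particular, $U_1U_2=qU_2U_1$, and the internal relations of the products are as follows. (Type I) For all $n,m\in\mathbf Z$: $\alpha(n,m)\gamma(n,m)=\gamma(n,m)\alpha(n,m)=q^{nm}$ and $\alpha(n,m)\beta(n,m)=\beta(n,m)\gamma(n,m)$. (Type II) For all $n,m\in\mathbf Z$: $\alpha(n,m)\gamma(n,m)=\gamma(n,m)\alpha(n,m)$ and $\alpha(n,m)\beta(n,m)=\beta(n,m)\gamma(n,m)$. (Type III) For all $n\in\mathbf Z$: $\alpha(n,n)\gamma(n,n)=\gamma(n,n)\alpha(n,n)$ and $\alpha(n,n)\beta(n,n)=r^n\beta(n,n)\gamma(n,n)$.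
   Context: Relations (those with index $i$ are required for $i=1,2$): (ID1) $\alpha_i\gamma_i=\gamma_i\alpha_i=1$. (ID2) $\alpha_i\gamma_i=\gamma_i\alpha_i$. (IND1) $\alpha_i\beta_i=\beta_i\gamma_i$. (IND2) $\alpha_i\beta_i=r\beta_i\gamma_i$. (MD1) $\alpha_1\alpha_2=q\alpha_2\alpha_1$. (MD2) $\alpha_1\alpha_2=q\alpha_2\alpha_1$, $\alpha_1\gamma_2=q^{-1}\gamma_2\alpha_1$, $\alpha_2\gamma_1=q\gamma_1\alpha_2$, $\gamma_1\gamma_2=q\gamma_2\gamma_1$. (MND) $\alpha_1\beta_2=q\beta_2\gamma_1$, $\beta_1\gamma_2=q\alpha_2\beta_1$. Internal relations are those involving entries of one matrix only (ID, IND) and have the same form for both matrices; mutual relations (MD, MND) involve entries of both matrices. Definition: a pair $(U_1,U_2)$ of invertible $2\times 2$ matrices over $\mathcal A$, with given internal relations (I) of the same form for both matrices and given mutual relations (M), is a quantum matrix pair if (a) $U_1U_2=qU_2U_1$ for some invertible $q\in k$, $q\neq1$ ($q$ acting by scalar multiplication), and (b) for all integers $n,m$ the entries of $U_1^nU_2^m$ obey internal relations with the same structure (I), up to possible substitution of scalar parameters. It is a restricted quantum matrix pair if (a) holds and (b) is only required to hold for the products $U_1^nU_2^n$, $n\in\mathbf Z$. Here the substitutions of scalar parameters are exactly those displayed in the claim ($1$ replaced by $q^{nm}$ in (ID1) for type I; $r$ replaced by $r^n$ in (IND2) for type III). *)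

theory Defs
  imports Main "HOL-Algebra.Group" "Jordan_Normal_Form.Matrix"
begin

(* The sort {ring, monoid_mult} is that of associative unital rings without the axiom 0 \<noteq> 1
   of ring_1, so that the zero algebra is not excluded. *)
locale unital_algebra = vector_space scale
  for scale :: "'k::field \<Rightarrow> 'a::{ring, monoid_mult} \<Rightarrow> 'a" +
  assumes scale_mult_left: "scale c x * y = scale c (x * y)"
    and scale_mult_right: "x * scale c y = scale c (x * y)"

definition invertible_elem :: "'a::monoid_mult \<Rightarrow> bool" where
  "invertible_elem x \<longleftrightarrow> (\<exists>y. x * y = 1 \<and> y * x = 1)"

definition mat2 :: "'a::{ring, monoid_mult} mat monoid" where
  "mat2 = \<lparr>carrier = carrier_mat 2 2, mult = (*), one = 1\<^sub>m 2\<rparr>"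

lemma monoid_mat2: "monoid (mat2 :: 'a::{ring, monoid_mult} mat monoid)"
proof (rule monoidI)
  fix A :: "'a mat" assume "A \<in> carrier mat2"
  then have A: "A \<in> carrier_mat 2 2" by (simp add: mat2_def)
  show "\<one>\<^bsub>mat2\<^esub> \<otimes>\<^bsub>mat2\<^esub> A = A" "A \<otimes>\<^bsub>mat2\<^esub> \<one>\<^bsub>mat2\<^esub> = A"
    using A by (auto simp: mat2_def scalar_prod_def numeral_2_eq_2 less_Suc_eq intro!: eq_matI)
qed (auto simp: mat2_def intro: assoc_mult_mat)

definition triu2 :: "'a::zero \<Rightarrow> 'a \<Rightarrow> 'a \<Rightarrow> 'a mat" where
  "triu2 a b c = mat_of_rows_list 2 [[a, b], [0, c]]"

abbreviation \<alpha>_of :: "'a mat \<Rightarrow> 'a" where "\<alpha>_of U \<equiv> U $$ (0, 0)"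
abbreviation \<beta>_of :: "'a mat \<Rightarrow> 'a" where "\<beta>_of U \<equiv> U $$ (0, 1)"
abbreviation \<gamma>_of :: "'a mat \<Rightarrow> 'a" where "\<gamma>_of U \<equiv> U $$ (1, 1)"

(* The constant 1 on the right-hand side of (ID1) is the scalar parameter c, which is 1 for the
   given matrices and gets replaced by another scalar for their products. *)
definition ID1 :: "('k \<Rightarrow> 'a \<Rightarrow> 'a) \<Rightarrow> 'k \<Rightarrow> 'a::{ring, monoid_mult} mat \<Rightarrow> bool" where
  "ID1 scale c U \<longleftrightarrow> \<alpha>_of U * \<gamma>_of U = scale c 1 \<and> \<gamma>_of U * \<alpha>_of U = scale c 1"

definition ID2 :: "'a::{ring, monoid_mult} mat \<Rightarrow> bool" where
  "ID2 U \<longleftrightarrow> \<alpha>_of U * \<gamma>_of U = \<gamma>_of U * \<alpha>_of U"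

definition IND1 :: "'a::{ring, monoid_mult} mat \<Rightarrow> bool" where
  "IND1 U \<longleftrightarrow> \<alpha>_of U * \<beta>_of U = \<beta>_of U * \<gamma>_of U"

definition IND2 :: "('k \<Rightarrow> 'a \<Rightarrow> 'a) \<Rightarrow> 'k \<Rightarrow> 'a::{ring, monoid_mult} mat \<Rightarrow> bool" where
  "IND2 scale r U \<longleftrightarrow> \<alpha>_of U * \<beta>_of U = scale r (\<beta>_of U * \<gamma>_of U)"

definition MD1 :: "('k \<Rightarrow> 'a \<Rightarrow> 'a) \<Rightarrow> 'k \<Rightarrow> 'a::{ring, monoid_mult} mat \<Rightarrow> 'a mat \<Rightarrow> bool" where
  "MD1 scale q U\<^sub>1 U\<^sub>2 \<longleftrightarrow> \<alpha>_of U\<^sub>1 * \<alpha>_of U\<^sub>2 = scale q (\<alpha>_of U\<^sub>2 * \<alpha>_of U\<^sub>1)"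

definition MD2 ::
  "('k::field \<Rightarrow> 'a \<Rightarrow> 'a) \<Rightarrow> 'k \<Rightarrow> 'a::{ring, monoid_mult} mat \<Rightarrow> 'a mat \<Rightarrow> bool" where
  "MD2 scale q U\<^sub>1 U\<^sub>2 \<longleftrightarrow>
     \<alpha>_of U\<^sub>1 * \<alpha>_of U\<^sub>2 = scale q (\<alpha>_of U\<^sub>2 * \<alpha>_of U\<^sub>1) \<and>
     \<alpha>_of U\<^sub>1 * \<gamma>_of U\<^sub>2 = scale (inverse q) (\<gamma>_of U\<^sub>2 * \<alpha>_of U\<^sub>1) \<and>
     \<alpha>_of U\<^sub>2 * \<gamma>_of U\<^sub>1 = scale q (\<gamma>_of U\<^sub>1 * \<alpha>_of U\<^sub>2) \<and>
     \<gamma>_of U\<^sub>1 * \<gamma>_of U\<^sub>2 = scale q (\<gamma>_of U\<^sub>2 * \<gamma>_of U\<^sub>1)"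

definition MND :: "('k \<Rightarrow> 'a \<Rightarrow> 'a) \<Rightarrow> 'k \<Rightarrow> 'a::{ring, monoid_mult} mat \<Rightarrow> 'a mat \<Rightarrow> bool" where
  "MND scale q U\<^sub>1 U\<^sub>2 \<longleftrightarrow>
     \<alpha>_of U\<^sub>1 * \<beta>_of U\<^sub>2 = scale q (\<beta>_of U\<^sub>2 * \<gamma>_of U\<^sub>1) \<and>
     \<beta>_of U\<^sub>1 * \<gamma>_of U\<^sub>2 = scale q (\<alpha>_of U\<^sub>2 * \<beta>_of U\<^sub>1)"

definition internal_I :: "('k \<Rightarrow> 'a \<Rightarrow> 'a) \<Rightarrow> 'k \<Rightarrow> 'a::{ring, monoid_mult} mat \<Rightarrow> bool" where
  "internal_I scale c U \<longleftrightarrow> ID1 scale c U \<and> IND1 U"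

definition internal_II :: "'a::{ring, monoid_mult} mat \<Rightarrow> bool" where
  "internal_II U \<longleftrightarrow> ID2 U \<and> IND1 U"

definition internal_III :: "('k \<Rightarrow> 'a \<Rightarrow> 'a) \<Rightarrow> 'k \<Rightarrow> 'a::{ring, monoid_mult} mat \<Rightarrow> bool" where
  "internal_III scale r U \<longleftrightarrow> ID2 U \<and> IND2 scale r U"

definition mutual_I ::
  "('k \<Rightarrow> 'a \<Rightarrow> 'a) \<Rightarrow> 'k \<Rightarrow> 'a::{ring, monoid_mult} mat \<Rightarrow> 'a mat \<Rightarrow> bool" where
  "mutual_I scale q U\<^sub>1 U\<^sub>2 \<longleftrightarrow> MD1 scale q U\<^sub>1 U\<^sub>2 \<and> MND scale q U\<^sub>1 U\<^sub>2"

definition mutual_II ::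
  "('k::field \<Rightarrow> 'a \<Rightarrow> 'a) \<Rightarrow> 'k \<Rightarrow> 'a::{ring, monoid_mult} mat \<Rightarrow> 'a mat \<Rightarrow> bool" where
  "mutual_II scale q U\<^sub>1 U\<^sub>2 \<longleftrightarrow> MD2 scale q U\<^sub>1 U\<^sub>2 \<and> MND scale q U\<^sub>1 U\<^sub>2"

definition type_I ::
  "('k::field \<Rightarrow> 'a \<Rightarrow> 'a) \<Rightarrow> 'k \<Rightarrow> 'a::{ring, monoid_mult} mat \<Rightarrow> 'a mat \<Rightarrow> bool" where
  "type_I scale q U\<^sub>1 U\<^sub>2 \<longleftrightarrow>
     internal_I scale 1 U\<^sub>1 \<and> internal_I scale 1 U\<^sub>2 \<and> mutual_I scale q U\<^sub>1 U\<^sub>2"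

definition type_II ::
  "('k::field \<Rightarrow> 'a \<Rightarrow> 'a) \<Rightarrow> 'k \<Rightarrow> 'a::{ring, monoid_mult} mat \<Rightarrow> 'a mat \<Rightarrow> bool" where
  "type_II scale q U\<^sub>1 U\<^sub>2 \<longleftrightarrow>
     internal_II U\<^sub>1 \<and> internal_II U\<^sub>2 \<and> mutual_II scale q U\<^sub>1 U\<^sub>2"

definition type_III ::
  "('k::field \<Rightarrow> 'a \<Rightarrow> 'a) \<Rightarrow> 'k \<Rightarrow> 'k \<Rightarrow> 'a::{ring, monoid_mult} mat \<Rightarrow> 'a mat \<Rightarrow> bool" where
  "type_III scale q r U\<^sub>1 U\<^sub>2 \<longleftrightarrow>
     internal_III scale r U\<^sub>1 \<and> internal_III scale r U\<^sub>2 \<and> mutual_II scale q U\<^sub>1 U\<^sub>2"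

definition q_commute ::
  "('k \<Rightarrow> 'a \<Rightarrow> 'a) \<Rightarrow> 'k \<Rightarrow> 'a::{ring, monoid_mult} mat \<Rightarrow> 'a mat \<Rightarrow> bool" where
  "q_commute scale q U\<^sub>1 U\<^sub>2 \<longleftrightarrow> U\<^sub>1 * U\<^sub>2 = map_mat (scale q) (U\<^sub>2 * U\<^sub>1)"

(* R p are the internal relations with scalar parameter p, p0 is the parameter for the two given
   matrices, \<sigma> the substitution giving the parameter for the products, M the mutual relations.
   The powers are those of the monoid mat2; for a unit they agree with the usual integer powers. *)
definition quantum_matrix_pair ::
  "('k::field \<Rightarrow> 'a \<Rightarrow> 'a) \<Rightarrow> ('p \<Rightarrow> 'a::{ring, monoid_mult} mat \<Rightarrow> bool) \<Rightarrow> 'p \<Rightarrow> (int \<Rightarrow> int \<Rightarrow> 'p)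
    \<Rightarrow> ('a mat \<Rightarrow> 'a mat \<Rightarrow> bool) \<Rightarrow> 'a mat \<Rightarrow> 'a mat \<Rightarrow> bool" where
  "quantum_matrix_pair scale R p0 \<sigma> M U\<^sub>1 U\<^sub>2 \<longleftrightarrow>
     U\<^sub>1 \<in> Units mat2 \<and> U\<^sub>2 \<in> Units mat2 \<and>
     R p0 U\<^sub>1 \<and> R p0 U\<^sub>2 \<and> M U\<^sub>1 U\<^sub>2 \<and>
     (\<exists>q. q \<noteq> 0 \<and> q \<noteq> 1 \<and> q_commute scale q U\<^sub>1 U\<^sub>2) \<and>
     (\<forall>n m :: int. R (\<sigma> n m) (U\<^sub>1 [^]\<^bsub>mat2\<^esub> n * U\<^sub>2 [^]\<^bsub>mat2\<^esub> m))"

definition restricted_quantum_matrix_pair ::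
  "('k::field \<Rightarrow> 'a \<Rightarrow> 'a) \<Rightarrow> ('p \<Rightarrow> 'a::{ring, monoid_mult} mat \<Rightarrow> bool) \<Rightarrow> 'p \<Rightarrow> (int \<Rightarrow> 'p)
    \<Rightarrow> ('a mat \<Rightarrow> 'a mat \<Rightarrow> bool) \<Rightarrow> 'a mat \<Rightarrow> 'a mat \<Rightarrow> bool" where
  "restricted_quantum_matrix_pair scale R p0 \<sigma> M U\<^sub>1 U\<^sub>2 \<longleftrightarrow>
     U\<^sub>1 \<in> Units mat2 \<and> U\<^sub>2 \<in> Units mat2 \<and>
     R p0 U\<^sub>1 \<and> R p0 U\<^sub>2 \<and> M U\<^sub>1 U\<^sub>2 \<and>
     (\<exists>q. q \<noteq> 0 \<and> q \<noteq> 1 \<and> q_commute scale q U\<^sub>1 U\<^sub>2) \<and>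
     (\<forall>n :: int. R (\<sigma> n) (U\<^sub>1 [^]\<^bsub>mat2\<^esub> n * U\<^sub>2 [^]\<^bsub>mat2\<^esub> n))"

end

theory Submission
  imports Defs
begin

text \<open>
  Every relation to be proved says that a diagonal matrix commutes with something up to a scalar,
  and such commutation is easily carried through products and powers. Write
  \<open>E\<^sub>i = diag(\<alpha>\<^sub>i, \<gamma>\<^sub>i)\<close> and let \<open>T\<^sub>i = diag(\<alpha>\<^sub>i, r\<gamma>\<^sub>i)\<close>, where \<open>r = 1\<close> for the first two
  types. Comparing entries, \<open>\<alpha>\<^sub>i\<beta>\<^sub>i = r\<beta>\<^sub>i\<gamma>\<^sub>i\<close> says that \<open>T\<^sub>i\<close> commutes with \<open>U\<^sub>i\<close>,
  and the mutual relations give \<open>E\<^sub>1 U\<^sub>2 = q U\<^sub>2 E\<^sub>1\<close> and \<open>E\<^sub>2 U\<^sub>1 = q\<^sup>-\<^sup>1 U\<^sub>1 E\<^sub>2\<close>.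

  Let \<open>W = U\<^sub>1\<^sup>n U\<^sub>2\<^sup>m\<close> have entries \<open>\<alpha>, \<beta>, \<gamma>\<close>. The matrix \<open>D = diag(\<alpha>, r\<^sup>n\<gamma>)\<close> equals
  \<open>T\<^sub>1\<^sup>n E\<^sub>2\<^sup>m\<close>, so moving it past \<open>U\<^sub>1\<close> costs \<open>q\<^sup>-\<^sup>m\<close>. If \<open>r\<^sup>n = r\<^sup>m\<close>, it also equals
  \<open>E\<^sub>1\<^sup>n T\<^sub>2\<^sup>m\<close>, so moving it past \<open>U\<^sub>2\<close> costs \<open>q\<^sup>n\<close>. Moving \<open>D\<close> past \<open>W\<close> therefore costs \<open>-nm\<close>
  and \<open>nm\<close> powers of \<open>q\<close>, which cancel: \<open>D W = W D\<close>, whose upper right entry is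
  \<open>\<alpha>\<beta> = r\<^sup>n \<beta>\<gamma>\<close>. The condition \<open>r\<^sup>n = r\<^sup>m\<close> is what restricts the third type to \<open>n = m\<close>. This is
  \<open>IND2_product\<close>. The same cancellation (\<open>qc_pow_product\<close>) with \<open>U\<^sub>i\<close> replaced by the flipped
  diagonals \<open>diag(\<gamma>\<^sub>i, \<alpha>\<^sub>i)\<close> gives \<open>\<alpha>\<gamma> = \<gamma>\<alpha>\<close> (\<open>ID2_product\<close>).

  The first type is a case of the second, since \<open>\<gamma>\<^sub>i\<close> is then the inverse of \<open>\<alpha>\<^sub>i\<close>
  (\<open>MD2_of_ID1\<close>). The value \<open>q\<^sup>n\<^sup>m\<close> of \<open>\<alpha>\<gamma>\<close> is the cost of exchanging \<open>\<alpha>\<^sub>1\<^sup>n\<close> and \<open>\<alpha>\<^sub>2\<^sup>m\<close>,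
  after which all factors of \<open>\<alpha>\<^sub>2\<^sup>m \<alpha>\<^sub>1\<^sup>n \<gamma>\<^sub>1\<^sup>n \<gamma>\<^sub>2\<^sup>m\<close> cancel (\<open>ID1_product\<close>).
\<close>

section \<open>Triangular two by two matrices\<close>

lemma triu2_index [simp]:
  "triu2 a b c $$ (0, 0) = a" "triu2 a b c $$ (0, Suc 0) = b"
  "triu2 a b c $$ (Suc 0, 0) = 0" "triu2 a b c $$ (Suc 0, Suc 0) = c"
  by (simp_all add: triu2_def mat_of_rows_list_def)

lemma triu2_dim [simp]: "dim_row (triu2 a b c) = 2" "dim_col (triu2 a b c) = 2"
  by (simp_all add: triu2_def mat_of_rows_list_def)

lemma triu2_carrier [simp]: "triu2 a b c \<in> carrier_mat 2 2"
  by (rule carrier_matI) simp_all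

lemma triu2_eq_iff: "triu2 a b c = triu2 a' b' c' \<longleftrightarrow> a = a' \<and> b = b' \<and> c = c'"
  by (metis triu2_index)

lemma triu2_mult:
  fixes a b c a' b' c' :: "'a::{ring, monoid_mult}"
  shows "triu2 a b c * triu2 a' b' c' = triu2 (a * a') (a * b' + b * c') (c * c')"
  by (rule eq_matI) (auto simp: scalar_prod_def numeral_2_eq_2 less_Suc_eq)

lemma triu2_one: "(1\<^sub>m 2 :: 'a::{ring, monoid_mult} mat) = triu2 1 0 1"
  by (rule eq_matI) (auto simp: less_2_cases_iff)

lemma upper_triangular_triu2: "upper_triangular (triu2 a b c)"
  by (auto simp: upper_triangular_def less_2_cases_iff)

section \<open>Integer powers\<close>

interpretation mat2: monoid "mat2 :: 'a::{ring, monoid_mult} mat monoid"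
  by (rule monoid_mat2)

lemma mat2_simps: "carrier mat2 = carrier_mat 2 2" "A \<otimes>\<^bsub>mat2\<^esub> B = A * B" "\<one>\<^bsub>mat2\<^esub> = 1\<^sub>m 2"
  by (simp_all add: mat2_def)

lemma mat2_one_mult:
  fixes A :: "'a::{ring, monoid_mult} mat"
  assumes "A \<in> carrier_mat 2 2"
  shows "1\<^sub>m 2 * A = A" "A * 1\<^sub>m 2 = A"
  using assms mat2.l_one[of A] mat2.r_one[of A] by (simp_all add: mat2_simps)

lemma mat2_Units_carrier: "U \<in> Units mat2 \<Longrightarrow> U \<in> carrier_mat 2 2"
  using mat2.Units_closed mat2_simps(1) by auto

lemma mat2_Units_inv:
  assumes "U \<in> Units mat2"
  shows "inv\<^bsub>mat2\<^esub> U \<in> carrier_mat 2 2" "U * inv\<^bsub>mat2\<^esub> U = 1\<^sub>m 2" "inv\<^bsub>mat2\<^esub> U * U = 1\<^sub>m 2"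
  using mat2.Units_inv_closed[OF assms] mat2.Units_r_inv[OF assms] mat2.Units_l_inv[OF assms]
  by (simp_all add: mat2_simps)

lemma mat2_nat_pow_Units: "U \<in> Units mat2 \<Longrightarrow> U [^]\<^bsub>mat2\<^esub> (n::nat) \<in> Units mat2"
  by (induction n) simp_all

text \<open>The laws of integer powers hold in the group of units; its inverses and powers agree
  with those of the monoid.\<close>

lemma mat2_int_pow_units_of:
  fixes n :: int
  assumes "U \<in> Units mat2"
  shows "U [^]\<^bsub>mat2\<^esub> n = U [^]\<^bsub>units_of mat2\<^esub> n"
proof (cases "0 \<le> n")
  case True
  then show ?thesis
    by (simp add: int_pow_def2 mat2.units_of_pow[OF assms] del: pow_nat)
next
  case False
  then show ?thesis
    by (simp add: int_pow_def2 mat2.units_of_pow[OF assms]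
        mat2.units_of_inv[OF mat2_nat_pow_Units[OF assms]] del: pow_nat)
qed

lemma mat2_int_pow_Units:
  "U \<in> Units mat2 \<Longrightarrow> U [^]\<^bsub>mat2\<^esub> (n::int) \<in> Units mat2"
  using group.int_pow_closed[OF mat2.units_group]
  by (simp add: mat2_int_pow_units_of units_of_carrier)

lemma mat2_int_pow_carrier:
  "U \<in> Units mat2 \<Longrightarrow> U [^]\<^bsub>mat2\<^esub> (n::int) \<in> carrier_mat 2 2"
  by (intro mat2_Units_carrier mat2_int_pow_Units)

lemma mat2_int_pow_add:
  fixes n m :: int
  assumes "U \<in> Units mat2"
  shows "U [^]\<^bsub>mat2\<^esub> (n + m) = U [^]\<^bsub>mat2\<^esub> n * U [^]\<^bsub>mat2\<^esub> m"
  using group.int_pow_mult[OF mat2.units_group] assms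
  by (metis mat2_int_pow_units_of units_of_carrier units_of_mult mat2_simps(2))

lemma mat2_int_pow_one: "U \<in> Units mat2 \<Longrightarrow> U [^]\<^bsub>mat2\<^esub> (1::int) = U"
  using group.int_pow_1[OF mat2.units_group]
  by (metis mat2_int_pow_units_of units_of_carrier)

lemma mat2_int_pow_minus_one: "U \<in> Units mat2 \<Longrightarrow> U [^]\<^bsub>mat2\<^esub> (-1::int) = inv\<^bsub>mat2\<^esub> U"
  using mat2.l_one[of U] by (simp add: int_pow_def2 mat2.Units_closed del: pow_nat)

lemma mat2_int_pow_inv:
  fixes n :: int
  assumes "U \<in> Units mat2"
  shows "(inv\<^bsub>mat2\<^esub> U) [^]\<^bsub>mat2\<^esub> n = U [^]\<^bsub>mat2\<^esub> (- n)"
  using group.int_pow_inv[OF mat2.units_group, of U n] group.int_pow_neg[OF mat2.units_group, of U n]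
    assms mat2.Units_inv_Units[OF assms]
  by (simp add: mat2_int_pow_units_of units_of_carrier mat2.units_of_inv)

lemma mat2_int_pow_induct:
  fixes P :: "int \<Rightarrow> 'a::{ring, monoid_mult} mat \<Rightarrow> bool"
  assumes U: "U \<in> Units mat2"
    and zero: "P 0 (1\<^sub>m 2)"
    and step: "\<And>n. P n (U [^]\<^bsub>mat2\<^esub> n) \<Longrightarrow> P (n + 1) (U [^]\<^bsub>mat2\<^esub> n * U)"
    and pred: "\<And>n. P n (U [^]\<^bsub>mat2\<^esub> n) \<Longrightarrow> P (n - 1) (U [^]\<^bsub>mat2\<^esub> n * inv\<^bsub>mat2\<^esub> U)"
  shows "P n (U [^]\<^bsub>mat2\<^esub> n)"
proof (induction n rule: int_induct[where k = 0])
  case base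
  show ?case using zero by (simp add: mat2_simps)
next
  case (step1 i)
  then show ?case
    using step[of i] mat2_int_pow_add[OF U, of i 1] mat2_int_pow_one[OF U] by simp
next
  case (step2 i)
  then show ?case
    using pred[of i] mat2_int_pow_add[OF U, of i "-1"] mat2_int_pow_minus_one[OF U] by simp
qed

lemma mat2_inv_eqI:
  assumes "A \<in> carrier_mat 2 2" "B \<in> carrier_mat 2 2" "A * B = 1\<^sub>m 2" "B * A = 1\<^sub>m 2"
  shows "A \<in> Units mat2" "inv\<^bsub>mat2\<^esub> A = B"
  using assms mat2.inv_char[of A B] by (auto simp: Units_def mat2_simps)

lemma triu2_inverse:
  assumes "a * a' = 1" "a' * a = 1" "c * c' = 1" "c' * c = 1"
  shows "triu2 a b c \<in> Units mat2"
    "inv\<^bsub>mat2\<^esub> (triu2 a b c) = triu2 a' (- (a' * b * c')) c'"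
proof -
  have "a * (a' * b * c') = b * c'"
    by (metis assms(1) mult.assoc mult_1)
  moreover have "a' * b * c' * c = a' * b"
    by (metis assms(4) mult.assoc mult_1_right)
  ultimately have "triu2 a b c * triu2 a' (- (a' * b * c')) c' = 1\<^sub>m 2"
    "triu2 a' (- (a' * b * c')) c' * triu2 a b c = 1\<^sub>m 2"
    using assms by (simp_all add: triu2_mult triu2_one triu2_eq_iff)
  then show "triu2 a b c \<in> Units mat2"
    "inv\<^bsub>mat2\<^esub> (triu2 a b c) = triu2 a' (- (a' * b * c')) c'"
    using mat2_inv_eqI[OF triu2_carrier triu2_carrier] by blast+
qed

lemma triu2_Units:
  "invertible_elem a \<Longrightarrow> invertible_elem c \<Longrightarrow> triu2 a b c \<in> Units mat2"
  unfolding invertible_elem_def using triu2_inverse(1) by blast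

text \<open>Sending a triangular matrix to its diagonal part, or to that part with its entries
  swapped, is multiplicative and hence compatible with integer powers.\<close>

lemma triu2_int_pow:
  assumes "invertible_elem a" "invertible_elem c"
  obtains x y z where "triu2 a b c [^]\<^bsub>mat2\<^esub> (n::int) = triu2 x y z"
    "triu2 a 0 c [^]\<^bsub>mat2\<^esub> n = triu2 x 0 z" "triu2 c 0 a [^]\<^bsub>mat2\<^esub> n = triu2 z 0 x"
proof -
  obtain a' c' where inv: "a * a' = 1" "a' * a = 1" "c * c' = 1" "c' * c = 1"
    using assms unfolding invertible_elem_def by blast
  let ?P = "\<lambda>(n::int) A. \<exists>x y z. A = triu2 x y z \<and>
    triu2 a 0 c [^]\<^bsub>mat2\<^esub> n = triu2 x 0 z \<and> triu2 c 0 a [^]\<^bsub>mat2\<^esub> n = triu2 z 0 x"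
  have ac: "triu2 a 0 c \<in> Units mat2" and ca: "triu2 c 0 a \<in> Units mat2"
    using assms by (simp_all add: triu2_Units)
  have "?P n (triu2 a b c [^]\<^bsub>mat2\<^esub> n)"
  proof (rule mat2_int_pow_induct[where P = ?P])
    show "?P 0 (1\<^sub>m 2)" by (auto simp: mat2_simps triu2_one)
  qed (use assms ac ca inv in
      \<open>auto simp: triu2_Units mat2_int_pow_add mat2_int_pow_one mat2_int_pow_minus_one
        triu2_inverse(2) triu2_mult diff_conv_add_uminus triu2_eq_iff simp del: add_uminus_conv_diff\<close>)
  then show thesis using that by blast
qed

section \<open>Commutation up to a scalar\<close>

context unital_algebra
begin

abbreviation qc :: "'k \<Rightarrow> 'a mat \<Rightarrow> 'a mat \<Rightarrow> bool" where
  "qc \<equiv> q_commute scale"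

lemma map_mat_scale_mult:
  assumes "A \<in> carrier_mat 2 2" "B \<in> carrier_mat 2 2"
  shows "map_mat (scale t) A * B = map_mat (scale t) (A * B)"
    "A * map_mat (scale t) B = map_mat (scale t) (A * B)"
  using assms
  by (auto intro!: eq_matI simp: scalar_prod_def numeral_2_eq_2 less_Suc_eq scale_mult_left
      scale_mult_right scale_right_distrib)

lemma map_mat_scale_scale: "map_mat (scale s) (map_mat (scale t) A) = map_mat (scale (s * t)) A"
  by (auto intro!: eq_matI)

lemma map_mat_scale_one: "map_mat (scale 1) A = A"
  by (auto intro!: eq_matI)

text \<open>The dictionary between commutation of matrices and the relations between their entries.\<close>

lemma qc_triu2_iff:
  "qc t (triu2 a b c) (triu2 a' b' c') \<longleftrightarrow>
     a * a' = scale t (a' * a) \<and> a * b' + b * c' = scale t (a' * b + b' * c) \<and>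
     c * c' = scale t (c' * c)"
proof -
  have "map_mat (scale t) (triu2 x y z) = triu2 (scale t x) (scale t y) (scale t z)" for x y z
    by (rule eq_matI) (auto simp: less_2_cases_iff)
  then show ?thesis
    by (simp add: q_commute_def triu2_mult triu2_eq_iff)
qed

lemma qc_mult_right:
  assumes "A \<in> carrier_mat 2 2" "B \<in> carrier_mat 2 2" "C \<in> carrier_mat 2 2"
    and "qc s A B" "qc t A C"
  shows "qc (s * t) A (B * C)"
proof -
  have "A * (B * C) = map_mat (scale s) (B * A) * C"
    using assms by (metis assoc_mult_mat q_commute_def)
  also have "\<dots> = map_mat (scale s) (B * (A * C))"
    using assms by (simp add: map_mat_scale_mult assoc_mult_mat[of _ 2 2 _ 2 _ 2])
  also have "\<dots> = map_mat (scale (s * t)) (B * C * A)"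
    using assms by (simp add: q_commute_def map_mat_scale_mult map_mat_scale_scale
        assoc_mult_mat[of _ 2 2 _ 2 _ 2])
  finally show ?thesis by (simp add: q_commute_def)
qed

lemma qc_sym: "t \<noteq> 0 \<Longrightarrow> qc t A B \<Longrightarrow> qc (inverse t) B A"
  by (simp add: q_commute_def map_mat_scale_scale map_mat_scale_one)

lemma qc_mult_left:
  assumes "A \<in> carrier_mat 2 2" "B \<in> carrier_mat 2 2" "C \<in> carrier_mat 2 2"
    and "qc s A C" "qc t B C" "s \<noteq> 0" "t \<noteq> 0"
  shows "qc (s * t) (A * B) C"
  using qc_sym[OF _ qc_mult_right[OF assms(3,1,2) qc_sym qc_sym]] assms by (simp add: field_simps)

text \<open>Conjugate the relation \<open>B A = t\<^sup>-\<^sup>1 A B\<close> by \<open>B\<close>.\<close>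

lemma qc_inv_right:
  assumes A: "A \<in> carrier_mat 2 2" and B: "B \<in> Units mat2" and "t \<noteq> 0" and AB: "qc t A B"
  shows "qc (inverse t) A (inv\<^bsub>mat2\<^esub> B)"
proof -
  let ?V = "inv\<^bsub>mat2\<^esub> B"
  note c = A mat2_Units_carrier[OF B] mat2_Units_inv(1)[OF B]
  note assoc = assoc_mult_mat[of _ 2 2 _ 2 _ 2]
  have "A * ?V = ?V * (B * A) * ?V"
    using c mat2_Units_inv(3)[OF B] by (metis assoc mult_carrier_mat mat2_one_mult(1))
  also have "B * A = map_mat (scale (inverse t)) (A * B)"
    using qc_sym[OF \<open>t \<noteq> 0\<close> AB] by (simp add: q_commute_def)
  also have "?V * map_mat (scale (inverse t)) (A * B) * ?V
      = map_mat (scale (inverse t)) (?V * A * (B * ?V))"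
    using c by (simp add: map_mat_scale_mult assoc)
  also have "?V * A * (B * ?V) = ?V * A"
    using c mat2_Units_inv(2)[OF B] by (metis mult_carrier_mat mat2_one_mult(2))
  finally show ?thesis by (simp add: q_commute_def)
qed

lemma qc_int_pow_right:
  assumes A: "A \<in> carrier_mat 2 2" and B: "B \<in> Units mat2" and t: "t \<noteq> 0" and AB: "qc t A B"
  shows "qc (t powi n) A (B [^]\<^bsub>mat2\<^esub> n)"
proof (rule mat2_int_pow_induct[OF B])
  note c = A mat2_Units_carrier[OF B] mat2_Units_inv(1)[OF B]
    mat2_int_pow_carrier[OF B]
  show "qc (t powi 0) A (1\<^sub>m 2)"
    using A by (simp add: q_commute_def map_mat_scale_one mat2_one_mult)
  show "qc (t powi (n + 1)) A (B [^]\<^bsub>mat2\<^esub> n * B)" if "qc (t powi n) A (B [^]\<^bsub>mat2\<^esub> n)" for n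
    using qc_mult_right[OF _ _ _ that AB] c t by (simp add: power_int_add)
  show "qc (t powi (n - 1)) A (B [^]\<^bsub>mat2\<^esub> n * inv\<^bsub>mat2\<^esub> B)"
    if "qc (t powi n) A (B [^]\<^bsub>mat2\<^esub> n)" for n
    using qc_mult_right[OF _ _ _ that qc_inv_right[OF A B t AB]] c t
    by (simp add: power_int_diff field_simps)
qed

lemma qc_int_pow_left:
  assumes A: "A \<in> Units mat2" and B: "B \<in> carrier_mat 2 2" and t: "t \<noteq> 0" and AB: "qc t A B"
  shows "qc (t powi n) (A [^]\<^bsub>mat2\<^esub> n) B"
  using qc_sym[OF _ qc_int_pow_right[OF B A _ qc_sym[OF t AB], of n]] t
  by (simp add: power_int_inverse)

lemma qc_int_pow:
  assumes A: "A \<in> Units mat2" and B: "B \<in> Units mat2" and t: "t \<noteq> 0" and AB: "qc t A B"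
  shows "qc (t powi (n * m)) (A [^]\<^bsub>mat2\<^esub> n) (B [^]\<^bsub>mat2\<^esub> m)"
  using qc_int_pow_right[OF _ B _ qc_int_pow_left[OF A _ t AB, where n = n], where n = m]
    mat2_Units_carrier[OF B] mat2_int_pow_carrier[OF A] t
  by (simp add: power_int_mult)

lemma qc_pow_product_left:
  assumes "A \<in> Units mat2" "B \<in> Units mat2" "C \<in> carrier_mat 2 2" "s \<noteq> 0" "t \<noteq> 0"
    and "qc s A C" "qc t B C"
  shows "qc (s powi n * t powi m) (A [^]\<^bsub>mat2\<^esub> n * B [^]\<^bsub>mat2\<^esub> m) C"
  using assms
  by (intro qc_mult_left qc_int_pow_left) (simp_all add: mat2_int_pow_carrier mat2_Units_carrier)

text \<open>Moving \<open>D\<close> past the two factors costs \<open>t\<^sup>-\<^sup>m\<^sup>n\<close> and \<open>t\<^sup>n\<^sup>m\<close>. The hypotheses hold when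
  \<open>D = E\<^sub>1\<^sup>n E\<^sub>2\<^sup>m\<close>, each \<open>E\<^sub>i\<close> commutes with its own factor, and \<open>E\<^sub>1\<close> past \<open>B\<close> and \<open>E\<^sub>2\<close> past \<open>A\<close>
  cost inverse scalars.\<close>

lemma qc_pow_product:
  assumes D: "D \<in> carrier_mat 2 2" and A: "A \<in> Units mat2" and B: "B \<in> Units mat2" and t: "t \<noteq> 0"
    and DA: "qc (t powi (- m)) D A" and DB: "qc (t powi n) D B"
  shows "D * (A [^]\<^bsub>mat2\<^esub> n * B [^]\<^bsub>mat2\<^esub> m) = A [^]\<^bsub>mat2\<^esub> n * B [^]\<^bsub>mat2\<^esub> m * D"
proof -
  have "qc ((t powi (- m)) powi n * (t powi n) powi m) D (A [^]\<^bsub>mat2\<^esub> n * B [^]\<^bsub>mat2\<^esub> m)"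
    using t A B
    by (intro qc_mult_right[OF D] qc_int_pow_right[OF D] DA DB mat2_int_pow_carrier) simp_all
  moreover have "(t powi (- m)) powi n * (t powi n) powi m = 1"
    using t by (simp add: power_int_minus power_int_inverse mult.commute flip: power_int_mult)
  ultimately show ?thesis
    by (simp add: q_commute_def map_mat_scale_one)
qed

lemma invertible_elem_scale:
  assumes "r \<noteq> 0" "invertible_elem c"
  shows "invertible_elem (scale r c)"
proof -
  obtain c' where "c * c' = 1" "c' * c = 1"
    using assms(2) by (auto simp: invertible_elem_def)
  then show ?thesis
    using assms(1) unfolding invertible_elem_def
    by (intro exI[of _ "scale (inverse r) c'"]) (simp add: scale_mult_left scale_mult_right)
qed

text \<open>Scalars are central, so the factor \<open>r\<close> can be collected; this computes the powers of the
  matrix \<open>diag(\<alpha>\<^sub>i, r\<gamma>\<^sub>i)\<close> that commutes with \<open>U\<^sub>i\<close>.\<close>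

lemma diag_scale_int_pow:
  fixes n :: int
  assumes "r \<noteq> 0" "invertible_elem a" "invertible_elem c"
    and pow: "triu2 a 0 c [^]\<^bsub>mat2\<^esub> n = triu2 x 0 z"
  shows "triu2 a 0 (scale r c) [^]\<^bsub>mat2\<^esub> n = triu2 x 0 (scale (r powi n) z)"
proof -
  obtain a' c' where inv: "a * a' = 1" "a' * a = 1" "c * c' = 1" "c' * c = 1"
    using assms(2,3) unfolding invertible_elem_def by blast
  have inv': "inv\<^bsub>mat2\<^esub> (triu2 a 0 (scale r c)) = triu2 a' 0 (scale (inverse r) c')"
    using inv \<open>r \<noteq> 0\<close>
    by (subst triu2_inverse(2)[where a' = a' and c' = "scale (inverse r) c'"])
       (simp_all add: scale_mult_left scale_mult_right)
  let ?P = "\<lambda>(n::int) A. \<exists>x z. triu2 a 0 c [^]\<^bsub>mat2\<^esub> n = triu2 x 0 z \<and>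
    A = triu2 x 0 (scale (r powi n) z)"
  have "?P n (triu2 a 0 (scale r c) [^]\<^bsub>mat2\<^esub> n)"
  proof (rule mat2_int_pow_induct[where P = ?P])
    show "triu2 a 0 (scale r c) \<in> Units mat2"
      using assms by (simp add: triu2_Units invertible_elem_scale)
    show "?P 0 (1\<^sub>m 2)" by (auto simp: mat2_simps triu2_one triu2_eq_iff)
  next
    fix n
    assume "?P n (triu2 a 0 (scale r c) [^]\<^bsub>mat2\<^esub> n)"
    then obtain x z where IH: "triu2 a 0 c [^]\<^bsub>mat2\<^esub> n = triu2 x 0 z"
      "triu2 a 0 (scale r c) [^]\<^bsub>mat2\<^esub> n = triu2 x 0 (scale (r powi n) z)" by blast
    have U: "triu2 a 0 c \<in> Units mat2" using assms by (simp add: triu2_Units)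
    have "triu2 a 0 c [^]\<^bsub>mat2\<^esub> (n + 1) = triu2 (x * a) 0 (z * c)"
      by (simp add: mat2_int_pow_add[OF U] mat2_int_pow_one[OF U] IH triu2_mult)
    then show "?P (n + 1) (triu2 a 0 (scale r c) [^]\<^bsub>mat2\<^esub> n * triu2 a 0 (scale r c))"
      using \<open>r \<noteq> 0\<close>
      by (auto simp: IH(2) triu2_mult triu2_eq_iff scale_mult_left scale_mult_right power_int_add
          mult.commute)
    have "triu2 a 0 c [^]\<^bsub>mat2\<^esub> (n + - 1) = triu2 (x * a') 0 (z * c')"
      by (simp add: mat2_int_pow_add[OF U] mat2_int_pow_minus_one[OF U] IH triu2_mult
          triu2_inverse(2)[OF inv] del: add_uminus_conv_diff)
    then show "?P (n - 1)
        (triu2 a 0 (scale r c) [^]\<^bsub>mat2\<^esub> n * inv\<^bsub>mat2\<^esub> (triu2 a 0 (scale r c)))"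
      using \<open>r \<noteq> 0\<close>
      by (auto simp: IH(2) inv' triu2_mult triu2_eq_iff scale_mult_left scale_mult_right
          power_int_diff divide_inverse mult.commute)
  qed
  then show ?thesis
    using pow by (auto simp: triu2_eq_iff)
qed

section \<open>The products of powers\<close>

text \<open>Two elements \<open>\<alpha>\<close> and \<open>\<gamma>\<close> commute exactly when \<open>diag(\<alpha>, \<gamma>)\<close> and \<open>diag(\<gamma>, \<alpha>)\<close> do. For the
  product both of these are products of powers of diagonal matrices built from \<open>U\<^sub>1\<close> and \<open>U\<^sub>2\<close>.\<close>

lemma ID2_product:
  fixes n m :: int
  assumes inv: "invertible_elem \<alpha>\<^sub>1" "invertible_elem \<gamma>\<^sub>1" "invertible_elem \<alpha>\<^sub>2" "invertible_elem \<gamma>\<^sub>2"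
    and q: "q \<noteq> 0"
    and id: "ID2 (triu2 \<alpha>\<^sub>1 \<beta>\<^sub>1 \<gamma>\<^sub>1)" "ID2 (triu2 \<alpha>\<^sub>2 \<beta>\<^sub>2 \<gamma>\<^sub>2)"
    and md: "MD2 scale q (triu2 \<alpha>\<^sub>1 \<beta>\<^sub>1 \<gamma>\<^sub>1) (triu2 \<alpha>\<^sub>2 \<beta>\<^sub>2 \<gamma>\<^sub>2)"
  shows "ID2 (triu2 \<alpha>\<^sub>1 \<beta>\<^sub>1 \<gamma>\<^sub>1 [^]\<^bsub>mat2\<^esub> n * triu2 \<alpha>\<^sub>2 \<beta>\<^sub>2 \<gamma>\<^sub>2 [^]\<^bsub>mat2\<^esub> m)"
proof -
  obtain x\<^sub>1 y\<^sub>1 z\<^sub>1 where 1: "triu2 \<alpha>\<^sub>1 \<beta>\<^sub>1 \<gamma>\<^sub>1 [^]\<^bsub>mat2\<^esub> n = triu2 x\<^sub>1 y\<^sub>1 z\<^sub>1"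
    "triu2 \<alpha>\<^sub>1 0 \<gamma>\<^sub>1 [^]\<^bsub>mat2\<^esub> n = triu2 x\<^sub>1 0 z\<^sub>1" "triu2 \<gamma>\<^sub>1 0 \<alpha>\<^sub>1 [^]\<^bsub>mat2\<^esub> n = triu2 z\<^sub>1 0 x\<^sub>1"
    by (rule triu2_int_pow[OF inv(1,2)])
  obtain x\<^sub>2 y\<^sub>2 z\<^sub>2 where 2: "triu2 \<alpha>\<^sub>2 \<beta>\<^sub>2 \<gamma>\<^sub>2 [^]\<^bsub>mat2\<^esub> m = triu2 x\<^sub>2 y\<^sub>2 z\<^sub>2"
    "triu2 \<alpha>\<^sub>2 0 \<gamma>\<^sub>2 [^]\<^bsub>mat2\<^esub> m = triu2 x\<^sub>2 0 z\<^sub>2" "triu2 \<gamma>\<^sub>2 0 \<alpha>\<^sub>2 [^]\<^bsub>mat2\<^esub> m = triu2 z\<^sub>2 0 x\<^sub>2"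
    by (rule triu2_int_pow[OF inv(3,4)])
  let ?E\<^sub>1 = "triu2 \<alpha>\<^sub>1 0 \<gamma>\<^sub>1" and ?E\<^sub>2 = "triu2 \<alpha>\<^sub>2 0 \<gamma>\<^sub>2"
    and ?F\<^sub>1 = "triu2 \<gamma>\<^sub>1 0 \<alpha>\<^sub>1" and ?F\<^sub>2 = "triu2 \<gamma>\<^sub>2 0 \<alpha>\<^sub>2"
    and ?D = "triu2 (x\<^sub>1 * x\<^sub>2) 0 (z\<^sub>1 * z\<^sub>2)"
  note units = triu2_Units[OF inv(1,2)] triu2_Units[OF inv(3,4)]
    triu2_Units[OF inv(2,1)] triu2_Units[OF inv(4,3)]
  have rels: "qc 1 ?E\<^sub>1 ?F\<^sub>1" "qc 1 ?E\<^sub>2 ?F\<^sub>2" "qc (inverse q) ?E\<^sub>1 ?F\<^sub>2" "qc q ?E\<^sub>2 ?F\<^sub>1"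
    using id md q by (simp_all add: qc_triu2_iff ID2_def MD2_def)
  have D: "?E\<^sub>1 [^]\<^bsub>mat2\<^esub> n * ?E\<^sub>2 [^]\<^bsub>mat2\<^esub> m = ?D"
    unfolding 1 2 by (simp add: triu2_mult)
  have scalar: "1 powi n * q powi m = inverse q powi (- m)"
    "inverse q powi n * 1 powi m = inverse q powi n"
    by (simp_all add: power_int_minus power_int_inverse)
  have "qc (inverse q powi (- m)) ?D ?F\<^sub>1"
    using qc_pow_product_left[OF units(1,2) triu2_carrier _ q rels(1,4), of n m]
    unfolding D scalar by simp
  moreover have "qc (inverse q powi n) ?D ?F\<^sub>2"
    using qc_pow_product_left[OF units(1,2) triu2_carrier _ _ rels(3,2), of n m] q
    unfolding D scalar by simp
  ultimately have "?D * (?F\<^sub>1 [^]\<^bsub>mat2\<^esub> n * ?F\<^sub>2 [^]\<^bsub>mat2\<^esub> m)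
      = ?F\<^sub>1 [^]\<^bsub>mat2\<^esub> n * ?F\<^sub>2 [^]\<^bsub>mat2\<^esub> m * ?D"
    using q by (intro qc_pow_product[where t = "inverse q", OF triu2_carrier units(3,4)]) simp_all
  then have "x\<^sub>1 * x\<^sub>2 * (z\<^sub>1 * z\<^sub>2) = z\<^sub>1 * z\<^sub>2 * (x\<^sub>1 * x\<^sub>2)"
    unfolding 1 2 triu2_mult triu2_eq_iff by blast
  then show ?thesis
    unfolding 1 2 triu2_mult ID2_def One_nat_def triu2_index .
qed

text \<open>The equality of \<open>r\<^sup>n\<close> and \<open>r\<^sup>m\<close> covers both \<open>r = 1\<close> with arbitrary exponents and arbitrary
  \<open>r\<close> with \<open>n = m\<close>. It makes the two ways of distributing the factor \<open>r\<close> produce the same diagonal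
  matrix.\<close>

lemma IND2_product:
  fixes n m :: int
  assumes inv: "invertible_elem \<alpha>\<^sub>1" "invertible_elem \<gamma>\<^sub>1" "invertible_elem \<alpha>\<^sub>2" "invertible_elem \<gamma>\<^sub>2"
    and q: "q \<noteq> 0" and r: "r \<noteq> 0" and nm: "r powi n = r powi m"
    and ind: "IND2 scale r (triu2 \<alpha>\<^sub>1 \<beta>\<^sub>1 \<gamma>\<^sub>1)" "IND2 scale r (triu2 \<alpha>\<^sub>2 \<beta>\<^sub>2 \<gamma>\<^sub>2)"
    and md: "MD2 scale q (triu2 \<alpha>\<^sub>1 \<beta>\<^sub>1 \<gamma>\<^sub>1) (triu2 \<alpha>\<^sub>2 \<beta>\<^sub>2 \<gamma>\<^sub>2)"
    and mnd: "MND scale q (triu2 \<alpha>\<^sub>1 \<beta>\<^sub>1 \<gamma>\<^sub>1) (triu2 \<alpha>\<^sub>2 \<beta>\<^sub>2 \<gamma>\<^sub>2)"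
  shows "IND2 scale (r powi n)
    (triu2 \<alpha>\<^sub>1 \<beta>\<^sub>1 \<gamma>\<^sub>1 [^]\<^bsub>mat2\<^esub> n * triu2 \<alpha>\<^sub>2 \<beta>\<^sub>2 \<gamma>\<^sub>2 [^]\<^bsub>mat2\<^esub> m)"
proof -
  let ?U\<^sub>1 = "triu2 \<alpha>\<^sub>1 \<beta>\<^sub>1 \<gamma>\<^sub>1" and ?U\<^sub>2 = "triu2 \<alpha>\<^sub>2 \<beta>\<^sub>2 \<gamma>\<^sub>2"
    and ?E\<^sub>1 = "triu2 \<alpha>\<^sub>1 0 \<gamma>\<^sub>1" and ?E\<^sub>2 = "triu2 \<alpha>\<^sub>2 0 \<gamma>\<^sub>2"
    and ?T\<^sub>1 = "triu2 \<alpha>\<^sub>1 0 (scale r \<gamma>\<^sub>1)" and ?T\<^sub>2 = "triu2 \<alpha>\<^sub>2 0 (scale r \<gamma>\<^sub>2)"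
  obtain x\<^sub>1 y\<^sub>1 z\<^sub>1 where 1: "?U\<^sub>1 [^]\<^bsub>mat2\<^esub> n = triu2 x\<^sub>1 y\<^sub>1 z\<^sub>1" "?E\<^sub>1 [^]\<^bsub>mat2\<^esub> n = triu2 x\<^sub>1 0 z\<^sub>1"
    by (rule triu2_int_pow[OF inv(1,2)])
  obtain x\<^sub>2 y\<^sub>2 z\<^sub>2 where 2: "?U\<^sub>2 [^]\<^bsub>mat2\<^esub> m = triu2 x\<^sub>2 y\<^sub>2 z\<^sub>2" "?E\<^sub>2 [^]\<^bsub>mat2\<^esub> m = triu2 x\<^sub>2 0 z\<^sub>2"
    by (rule triu2_int_pow[OF inv(3,4)])
  note T = diag_scale_int_pow[OF r inv(1,2) 1(2)] diag_scale_int_pow[OF r inv(3,4) 2(2)]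
  let ?D = "triu2 (x\<^sub>1 * x\<^sub>2) 0 (scale (r powi n) (z\<^sub>1 * z\<^sub>2))"
  note units = triu2_Units[OF inv(1,2)] triu2_Units[OF inv(3,4)]
    triu2_Units[OF inv(1) invertible_elem_scale[OF r inv(2)]]
    triu2_Units[OF inv(3) invertible_elem_scale[OF r inv(4)]]
  \<comment> \<open>One diagonal matrix with two factorisations, each adapted to one of the \<open>U\<^sub>i\<close>.\<close>
  have D: "?T\<^sub>1 [^]\<^bsub>mat2\<^esub> n * ?E\<^sub>2 [^]\<^bsub>mat2\<^esub> m = ?D" "?E\<^sub>1 [^]\<^bsub>mat2\<^esub> n * ?T\<^sub>2 [^]\<^bsub>mat2\<^esub> m = ?D"
    by (simp_all add: 1 2 T nm triu2_mult scale_mult_left scale_mult_right)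
  have rels: "qc 1 ?T\<^sub>1 ?U\<^sub>1" "qc (inverse q) ?E\<^sub>2 ?U\<^sub>1" "qc q ?E\<^sub>1 ?U\<^sub>2" "qc 1 ?T\<^sub>2 ?U\<^sub>2"
    using ind md mnd q
    by (simp_all add: qc_triu2_iff IND2_def MD2_def MND_def scale_mult_left scale_mult_right)
  have scalar: "1 powi n * inverse q powi m = q powi (- m)" "q powi n * 1 powi m = q powi n"
    by (simp_all add: power_int_minus power_int_inverse)
  have "qc (q powi (- m)) ?D ?U\<^sub>1"
    using qc_pow_product_left[OF units(3,2) triu2_carrier _ _ rels(1,2), of n m] q
    unfolding D scalar by simp
  moreover have "qc (q powi n) ?D ?U\<^sub>2"
    using qc_pow_product_left[OF units(1,4) triu2_carrier q _ rels(3,4), of n m]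
    unfolding D scalar by simp
  ultimately have "?D * (?U\<^sub>1 [^]\<^bsub>mat2\<^esub> n * ?U\<^sub>2 [^]\<^bsub>mat2\<^esub> m)
      = ?U\<^sub>1 [^]\<^bsub>mat2\<^esub> n * ?U\<^sub>2 [^]\<^bsub>mat2\<^esub> m * ?D"
    using q by (intro qc_pow_product[where t = q, OF triu2_carrier units(1,2)]) simp_all
  then show ?thesis
    unfolding 1 2 triu2_mult triu2_eq_iff IND2_def One_nat_def triu2_index
    by (simp add: scale_mult_right)
qed

lemma q_commute_triu2:
  assumes "MD2 scale q (triu2 \<alpha>\<^sub>1 \<beta>\<^sub>1 \<gamma>\<^sub>1) (triu2 \<alpha>\<^sub>2 \<beta>\<^sub>2 \<gamma>\<^sub>2)"
    and "MND scale q (triu2 \<alpha>\<^sub>1 \<beta>\<^sub>1 \<gamma>\<^sub>1) (triu2 \<alpha>\<^sub>2 \<beta>\<^sub>2 \<gamma>\<^sub>2)"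
  shows "qc q (triu2 \<alpha>\<^sub>1 \<beta>\<^sub>1 \<gamma>\<^sub>1) (triu2 \<alpha>\<^sub>2 \<beta>\<^sub>2 \<gamma>\<^sub>2)"
  using assms by (simp add: qc_triu2_iff MD2_def MND_def scale_right_distrib add.commute)

text \<open>A relation \<open>x a = s a x\<close> with \<open>a\<close> invertible passes to the inverse of \<open>a\<close> with \<open>s\<close> inverted;
  here \<open>\<gamma>\<^sub>i\<close> is the inverse of \<open>\<alpha>\<^sub>i\<close>.\<close>

lemma MD2_of_ID1:
  assumes q: "q \<noteq> 0" and "ID1 scale 1 (triu2 \<alpha>\<^sub>1 \<beta>\<^sub>1 \<gamma>\<^sub>1)" "ID1 scale 1 (triu2 \<alpha>\<^sub>2 \<beta>\<^sub>2 \<gamma>\<^sub>2)"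
    and "MD1 scale q (triu2 \<alpha>\<^sub>1 \<beta>\<^sub>1 \<gamma>\<^sub>1) (triu2 \<alpha>\<^sub>2 \<beta>\<^sub>2 \<gamma>\<^sub>2)"
  shows "MD2 scale q (triu2 \<alpha>\<^sub>1 \<beta>\<^sub>1 \<gamma>\<^sub>1) (triu2 \<alpha>\<^sub>2 \<beta>\<^sub>2 \<gamma>\<^sub>2)"
proof -
  have inv: "\<alpha>\<^sub>1 * \<gamma>\<^sub>1 = 1" "\<gamma>\<^sub>1 * \<alpha>\<^sub>1 = 1" "\<alpha>\<^sub>2 * \<gamma>\<^sub>2 = 1" "\<gamma>\<^sub>2 * \<alpha>\<^sub>2 = 1"
    and comm: "\<alpha>\<^sub>1 * \<alpha>\<^sub>2 = scale q (\<alpha>\<^sub>2 * \<alpha>\<^sub>1)"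
    using assms by (simp_all add: ID1_def MD1_def)
  have *: "x * c' = scale (inverse s) (c' * x)"
    if "x * a' = scale s (a' * x)" "a' * c' = 1" "c' * a' = 1" "s \<noteq> 0" for x a' c' s
  proof -
    have "c' * x = c' * (x * a') * c'"
      using that(2) by (simp add: mult.assoc)
    also have "\<dots> = scale s (c' * a' * (x * c'))"
      using that(1) by (simp add: scale_mult_left scale_mult_right mult.assoc)
    finally show ?thesis
      using that(3,4) by simp
  qed
  have comm': "\<alpha>\<^sub>2 * \<alpha>\<^sub>1 = scale (inverse q) (\<alpha>\<^sub>1 * \<alpha>\<^sub>2)"
    using comm q by simp
  have "\<alpha>\<^sub>1 * \<gamma>\<^sub>2 = scale (inverse q) (\<gamma>\<^sub>2 * \<alpha>\<^sub>1)"
    using *[OF comm inv(3,4) q] .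
  moreover have 21: "\<alpha>\<^sub>2 * \<gamma>\<^sub>1 = scale q (\<gamma>\<^sub>1 * \<alpha>\<^sub>2)"
    using *[OF comm' inv(1,2)] q by simp
  moreover have "\<gamma>\<^sub>1 * \<alpha>\<^sub>2 = scale (inverse q) (\<alpha>\<^sub>2 * \<gamma>\<^sub>1)"
    using 21 q by simp
  from *[OF this inv(3,4)] q have "\<gamma>\<^sub>1 * \<gamma>\<^sub>2 = scale q (\<gamma>\<^sub>2 * \<gamma>\<^sub>1)"
    by simp
  ultimately show ?thesis
    using comm by (simp add: MD2_def)
qed

text \<open>Exchange \<open>\<alpha>\<^sub>1\<^sup>n\<close> and \<open>\<alpha>\<^sub>2\<^sup>m\<close> at the cost of \<open>q\<^sup>n\<^sup>m\<close>; the product with \<open>\<gamma>\<^sub>1\<^sup>n \<gamma>\<^sub>2\<^sup>m\<close> then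
  collapses from the middle outwards.\<close>

lemma ID1_product:
  fixes n m :: int
  assumes q: "q \<noteq> 0" and id: "ID1 scale 1 (triu2 \<alpha>\<^sub>1 \<beta>\<^sub>1 \<gamma>\<^sub>1)" "ID1 scale 1 (triu2 \<alpha>\<^sub>2 \<beta>\<^sub>2 \<gamma>\<^sub>2)"
    and md: "MD1 scale q (triu2 \<alpha>\<^sub>1 \<beta>\<^sub>1 \<gamma>\<^sub>1) (triu2 \<alpha>\<^sub>2 \<beta>\<^sub>2 \<gamma>\<^sub>2)"
  shows "ID1 scale (q powi (n * m))
    (triu2 \<alpha>\<^sub>1 \<beta>\<^sub>1 \<gamma>\<^sub>1 [^]\<^bsub>mat2\<^esub> n * triu2 \<alpha>\<^sub>2 \<beta>\<^sub>2 \<gamma>\<^sub>2 [^]\<^bsub>mat2\<^esub> m)"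
proof -
  have inverse_diag: "\<alpha>\<^sub>1 * \<gamma>\<^sub>1 = 1" "\<gamma>\<^sub>1 * \<alpha>\<^sub>1 = 1" "\<alpha>\<^sub>2 * \<gamma>\<^sub>2 = 1" "\<gamma>\<^sub>2 * \<alpha>\<^sub>2 = 1"
    using id by (simp_all add: ID1_def)
  then have inv: "invertible_elem \<alpha>\<^sub>1" "invertible_elem \<gamma>\<^sub>1" "invertible_elem \<alpha>\<^sub>2" "invertible_elem \<gamma>\<^sub>2"
    unfolding invertible_elem_def by blast+
  have MD2: "MD2 scale q (triu2 \<alpha>\<^sub>1 \<beta>\<^sub>1 \<gamma>\<^sub>1) (triu2 \<alpha>\<^sub>2 \<beta>\<^sub>2 \<gamma>\<^sub>2)"
    using MD2_of_ID1[OF q id md] .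
  obtain x\<^sub>1 y\<^sub>1 z\<^sub>1 where 1: "triu2 \<alpha>\<^sub>1 \<beta>\<^sub>1 \<gamma>\<^sub>1 [^]\<^bsub>mat2\<^esub> n = triu2 x\<^sub>1 y\<^sub>1 z\<^sub>1"
    "triu2 \<alpha>\<^sub>1 0 \<gamma>\<^sub>1 [^]\<^bsub>mat2\<^esub> n = triu2 x\<^sub>1 0 z\<^sub>1" "triu2 \<gamma>\<^sub>1 0 \<alpha>\<^sub>1 [^]\<^bsub>mat2\<^esub> n = triu2 z\<^sub>1 0 x\<^sub>1"
    by (rule triu2_int_pow[OF inv(1,2)])
  obtain x\<^sub>2 y\<^sub>2 z\<^sub>2 where 2: "triu2 \<alpha>\<^sub>2 \<beta>\<^sub>2 \<gamma>\<^sub>2 [^]\<^bsub>mat2\<^esub> m = triu2 x\<^sub>2 y\<^sub>2 z\<^sub>2"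
    "triu2 \<alpha>\<^sub>2 0 \<gamma>\<^sub>2 [^]\<^bsub>mat2\<^esub> m = triu2 x\<^sub>2 0 z\<^sub>2" "triu2 \<gamma>\<^sub>2 0 \<alpha>\<^sub>2 [^]\<^bsub>mat2\<^esub> m = triu2 z\<^sub>2 0 x\<^sub>2"
    by (rule triu2_int_pow[OF inv(3,4)])
  have "qc (q powi (n * m)) (triu2 x\<^sub>1 0 z\<^sub>1) (triu2 x\<^sub>2 0 z\<^sub>2)"
    using qc_int_pow[OF triu2_Units[OF inv(1,2)] triu2_Units[OF inv(3,4)] q, of 0 0 n m] MD2
    by (simp add: qc_triu2_iff MD2_def 1 2)
  then have xx: "x\<^sub>1 * x\<^sub>2 = scale (q powi (n * m)) (x\<^sub>2 * x\<^sub>1)"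
    by (simp add: qc_triu2_iff)
  have pow_inverse: "triu2 a 0 c [^]\<^bsub>mat2\<^esub> k * triu2 c 0 a [^]\<^bsub>mat2\<^esub> k = 1\<^sub>m 2"
    if ac: "a * c = 1" "c * a = 1" for a c :: 'a and k :: int
  proof -
    have U: "triu2 a 0 c \<in> Units mat2" and V: "triu2 c 0 a = inv\<^bsub>mat2\<^esub> (triu2 a 0 c)"
      using triu2_inverse[OF ac ac(2,1)] by simp_all
    have "triu2 c 0 a [^]\<^bsub>mat2\<^esub> k = triu2 a 0 c [^]\<^bsub>mat2\<^esub> (- k)"
      using mat2_int_pow_inv[OF U] V by simp
    then show ?thesis
      using mat2_int_pow_add[OF U, of k "- k"] by (simp add: mat2_simps)
  qed
  have "x\<^sub>1 * z\<^sub>1 = 1" "x\<^sub>2 * z\<^sub>2 = 1"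
    using pow_inverse[OF inverse_diag(1,2), of n] pow_inverse[OF inverse_diag(3,4), of m]
    by (simp_all add: 1 2 triu2_mult triu2_one triu2_eq_iff)
  then have "x\<^sub>2 * x\<^sub>1 * (z\<^sub>1 * z\<^sub>2) = 1"
    by (metis mult.assoc mult_1)
  then have "x\<^sub>1 * x\<^sub>2 * (z\<^sub>1 * z\<^sub>2) = scale (q powi (n * m)) 1"
    by (simp add: xx scale_mult_left)
  moreover have "ID2 (triu2 \<alpha>\<^sub>1 \<beta>\<^sub>1 \<gamma>\<^sub>1 [^]\<^bsub>mat2\<^esub> n * triu2 \<alpha>\<^sub>2 \<beta>\<^sub>2 \<gamma>\<^sub>2 [^]\<^bsub>mat2\<^esub> m)"
    using id by (intro ID2_product[OF inv q _ _ MD2]) (simp_all add: ID1_def ID2_def)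
  ultimately show ?thesis
    by (simp add: ID1_def ID2_def 1 2 triu2_mult)
qed

end

section \<open>Quantum matrix pairs\<close>

theorem theorem1:
  fixes scale :: "'k::field \<Rightarrow> 'a::{ring, monoid_mult} \<Rightarrow> 'a"
    and \<alpha>\<^sub>1 \<beta>\<^sub>1 \<gamma>\<^sub>1 \<alpha>\<^sub>2 \<beta>\<^sub>2 \<gamma>\<^sub>2 :: 'a
    and U\<^sub>1 U\<^sub>2 :: "'a mat" and P :: "int \<Rightarrow> int \<Rightarrow> 'a mat"
    and q :: 'k
  assumes "unital_algebra scale"
    and "invertible_elem \<alpha>\<^sub>1" and "invertible_elem \<gamma>\<^sub>1"
    and "invertible_elem \<alpha>\<^sub>2" and "invertible_elem \<gamma>\<^sub>2"
    and "q \<noteq> 0" and "q \<noteq> 1"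
  defines "U\<^sub>1 \<equiv> triu2 \<alpha>\<^sub>1 \<beta>\<^sub>1 \<gamma>\<^sub>1"
    and "U\<^sub>2 \<equiv> triu2 \<alpha>\<^sub>2 \<beta>\<^sub>2 \<gamma>\<^sub>2"
    and "P \<equiv> \<lambda>n m. U\<^sub>1 [^]\<^bsub>mat2\<^esub> n * U\<^sub>2 [^]\<^bsub>mat2\<^esub> m"
  shows "(\<forall>n m. upper_triangular (P n m)) \<and>
    (type_I scale q U\<^sub>1 U\<^sub>2 \<longrightarrow>
       quantum_matrix_pair scale (internal_I scale) 1 (\<lambda>n m. q powi (n * m))
         (mutual_I scale q) U\<^sub>1 U\<^sub>2 \<and>
       q_commute scale q U\<^sub>1 U\<^sub>2 \<and>
       (\<forall>n m. \<alpha>_of (P n m) * \<gamma>_of (P n m) = scale (q powi (n * m)) 1 \<and>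
              \<gamma>_of (P n m) * \<alpha>_of (P n m) = scale (q powi (n * m)) 1 \<and>
              \<alpha>_of (P n m) * \<beta>_of (P n m) = \<beta>_of (P n m) * \<gamma>_of (P n m))) \<and>
    (type_II scale q U\<^sub>1 U\<^sub>2 \<longrightarrow>
       quantum_matrix_pair scale (\<lambda>_. internal_II) () (\<lambda>_ _. ())
         (mutual_II scale q) U\<^sub>1 U\<^sub>2 \<and>
       q_commute scale q U\<^sub>1 U\<^sub>2 \<and>
       (\<forall>n m. \<alpha>_of (P n m) * \<gamma>_of (P n m) = \<gamma>_of (P n m) * \<alpha>_of (P n m) \<and>
              \<alpha>_of (P n m) * \<beta>_of (P n m) = \<beta>_of (P n m) * \<gamma>_of (P n m))) \<and>
    (\<forall>r. r \<noteq> 0 \<longrightarrow> r \<noteq> 1 \<longrightarrow> type_III scale q r U\<^sub>1 U\<^sub>2 \<longrightarrow>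
       restricted_quantum_matrix_pair scale (internal_III scale) r (\<lambda>n. r powi n)
         (mutual_II scale q) U\<^sub>1 U\<^sub>2 \<and>
       q_commute scale q U\<^sub>1 U\<^sub>2 \<and>
       (\<forall>n. \<alpha>_of (P n n) * \<gamma>_of (P n n) = \<gamma>_of (P n n) * \<alpha>_of (P n n) \<and>
            \<alpha>_of (P n n) * \<beta>_of (P n n) = scale (r powi n) (\<beta>_of (P n n) * \<gamma>_of (P n n))))"
proof -
  interpret unital_algebra scale by fact
  note inv = assms(2-5) and q = assms(6,7)
  have units: "U\<^sub>1 \<in> Units mat2" "U\<^sub>2 \<in> Units mat2"
    using inv by (simp_all add: U\<^sub>1_def U\<^sub>2_def triu2_Units)
  have triangular: "upper_triangular (P n m)" for n m
  proof -
    obtain x y z where "U\<^sub>1 [^]\<^bsub>mat2\<^esub> n = triu2 x y z"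
      unfolding U\<^sub>1_def by (rule triu2_int_pow[OF inv(1,2)])
    moreover obtain x' y' z' where "U\<^sub>2 [^]\<^bsub>mat2\<^esub> m = triu2 x' y' z'"
      unfolding U\<^sub>2_def by (rule triu2_int_pow[OF inv(3,4)])
    ultimately show ?thesis
      by (simp add: P_def triu2_mult upper_triangular_triu2)
  qed
  \<comment> \<open>Types I and II are the case \<open>r = 1\<close>, where all pairs of exponents are admissible.\<close>
  have IND2_one: "IND1 U \<longleftrightarrow> IND2 scale 1 U" for U
    by (simp add: IND1_def IND2_def)
  have ID2_P: "ID2 (P n m)" if "ID2 U\<^sub>1" "ID2 U\<^sub>2" "MD2 scale q U\<^sub>1 U\<^sub>2" for n m
    using ID2_product[OF inv q(1)] that unfolding P_def U\<^sub>1_def U\<^sub>2_def by blast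
  have IND2_P: "IND2 scale (r powi n) (P n m)"
    if "r \<noteq> 0" "r powi n = r powi m" "IND2 scale r U\<^sub>1" "IND2 scale r U\<^sub>2"
      "MD2 scale q U\<^sub>1 U\<^sub>2" "MND scale q U\<^sub>1 U\<^sub>2" for r n m
    using IND2_product[OF inv q(1)] that unfolding P_def U\<^sub>1_def U\<^sub>2_def by blast
  have IND1_P: "IND1 (P n m)" if "internal_II U\<^sub>1" "internal_II U\<^sub>2" "mutual_II scale q U\<^sub>1 U\<^sub>2" for n m
    using IND2_P[of 1 n m] that by (simp add: IND2_one internal_II_def mutual_II_def)
  have commute: "q_commute scale q U\<^sub>1 U\<^sub>2" if "mutual_II scale q U\<^sub>1 U\<^sub>2"
    using q_commute_triu2 that unfolding U\<^sub>1_def U\<^sub>2_def mutual_II_def by blast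
  have I: "quantum_matrix_pair scale (internal_I scale) 1 (\<lambda>n m. q powi (n * m))
      (mutual_I scale q) U\<^sub>1 U\<^sub>2 \<and> q_commute scale q U\<^sub>1 U\<^sub>2 \<and>
      (\<forall>n m. ID1 scale (q powi (n * m)) (P n m) \<and> IND1 (P n m))"
    if type: "type_I scale q U\<^sub>1 U\<^sub>2"
  proof -
    have rels: "ID1 scale 1 U\<^sub>1" "ID1 scale 1 U\<^sub>2" "IND1 U\<^sub>1" "IND1 U\<^sub>2" "MD1 scale q U\<^sub>1 U\<^sub>2"
      "MND scale q U\<^sub>1 U\<^sub>2"
      using type by (simp_all add: type_I_def internal_I_def mutual_I_def)
    have "internal_II U\<^sub>1" "internal_II U\<^sub>2"
      using rels by (simp_all add: internal_II_def ID1_def ID2_def)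
    moreover have "mutual_II scale q U\<^sub>1 U\<^sub>2"
      using MD2_of_ID1[OF q(1)] rels unfolding U\<^sub>1_def U\<^sub>2_def mutual_II_def by blast
    moreover have "ID1 scale (q powi (n * m)) (P n m)" for n m
      using ID1_product[OF q(1)] rels unfolding P_def U\<^sub>1_def U\<^sub>2_def by blast
    ultimately show ?thesis
      using IND1_P commute type units q
      unfolding quantum_matrix_pair_def type_I_def internal_I_def P_def by blast
  qed
  have II: "quantum_matrix_pair scale (\<lambda>_. internal_II) () (\<lambda>_ _. ()) (mutual_II scale q) U\<^sub>1 U\<^sub>2 \<and>
      q_commute scale q U\<^sub>1 U\<^sub>2 \<and> (\<forall>n m. ID2 (P n m) \<and> IND1 (P n m))"
    if "type_II scale q U\<^sub>1 U\<^sub>2"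
    using that ID2_P IND1_P commute units q
    unfolding quantum_matrix_pair_def type_II_def internal_II_def mutual_II_def P_def by blast
  have III: "restricted_quantum_matrix_pair scale (internal_III scale) r (\<lambda>n. r powi n)
      (mutual_II scale q) U\<^sub>1 U\<^sub>2 \<and> q_commute scale q U\<^sub>1 U\<^sub>2 \<and>
      (\<forall>n. ID2 (P n n) \<and> IND2 scale (r powi n) (P n n))"
    if "r \<noteq> 0" "type_III scale q r U\<^sub>1 U\<^sub>2" for r
    using that ID2_P IND2_P[OF _ refl] commute units q
    unfolding restricted_quantum_matrix_pair_def type_III_def internal_III_def mutual_II_def P_def
    by blast
  show ?thesis
    using triangular I II III unfolding ID1_def ID2_def IND1_def IND2_def by blast
qed

end
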